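(* Let $R$ be a commutative ring. Then the following four statements are equivalent: (1) $R$ is strongly $\Delta$-clean; (2) $R$ is uniquely clean; (3) $T_n(R)$ is strongly $\Delta$-clean for some $n\ge 1$; (4) $T_n(R)$ is strongly $\Delta$-clean for all $n\ge 1$.
   Context: Rings are associative with identity. $T_n(R)$ is the ring of $n\times n$ upper triangular matrices over $R$. For a (not necessarily commutative) ring $S$, $U(S)$ is the group of units and $\Delta(S)=\{x\in S \mid 1-xu\in U(S)\text{ for all }u\in U(S)\}$. A ring $S$ is strongly $\Delta$-clean if every $a\in S$ can be written $a=e+d$ with $e^2=e\in S$, $d\in\Delta(S)$ and $ed=de$. A ring $S$ is uniquely clean if each element of $S$ has a unique representation as the sum of an idempotent and a unit. *)

theory Defs
  imports "HOL-Algebra.Ring" "Jordan_Normal_Form.Matrix"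
begin

definition idempotents :: "('a, 'm) ring_scheme \<Rightarrow> 'a set" where
  "idempotents S = {e \<in> carrier S. e \<otimes>\<^bsub>S\<^esub> e = e}"

definition Delta :: "('a, 'm) ring_scheme \<Rightarrow> 'a set" where
  "Delta S = {x \<in> carrier S. \<forall>u \<in> Units S. \<one>\<^bsub>S\<^esub> \<ominus>\<^bsub>S\<^esub> x \<otimes>\<^bsub>S\<^esub> u \<in> Units S}"

definition strongly_Delta_clean :: "('a, 'm) ring_scheme \<Rightarrow> bool" where
  "strongly_Delta_clean S \<longleftrightarrow>
     (\<forall>a \<in> carrier S. \<exists>e \<in> idempotents S. \<exists>d \<in> Delta S.
        a = e \<oplus>\<^bsub>S\<^esub> d \<and> e \<otimes>\<^bsub>S\<^esub> d = d \<otimes>\<^bsub>S\<^esub> e)"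

definition uniquely_clean :: "('a, 'm) ring_scheme \<Rightarrow> bool" where
  "uniquely_clean S \<longleftrightarrow>
     (\<forall>a \<in> carrier S. \<exists>!p. p \<in> idempotents S \<times> Units S \<and> a = fst p \<oplus>\<^bsub>S\<^esub> snd p)"

text \<open>The matrix operations of \<^theory>\<open>Jordan_Normal_Form.Matrix\<close> use the type-class arithmetic on
  the entries, and the class \<^class>\<open>comm_ring_1\<close> excludes the zero ring. Here the entries come from
  the carrier of an arbitrary ring record, so only the type of matrices and its index function are
  used. Rows and columns are numbered from 0.\<close>

definition upper_triangular_ring :: "('a, 'm) ring_scheme \<Rightarrow> nat \<Rightarrow> 'a mat ring" where
  "upper_triangular_ring R n =
     \<lparr>carrier = {A \<in> carrier_mat n n.
         (\<forall>i<n. \<forall>j<n. A $$ (i, j) \<in> carrier R) \<and> (\<forall>i<n. \<forall>j<i. A $$ (i, j) = \<zero>\<^bsub>R\<^esub>)},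
      mult = (\<lambda>A B. mat n n (\<lambda>(i, j). \<Oplus>\<^bsub>R\<^esub>k\<in>{..<n}. A $$ (i, k) \<otimes>\<^bsub>R\<^esub> B $$ (k, j))),
      one = mat n n (\<lambda>(i, j). if i = j then \<one>\<^bsub>R\<^esub> else \<zero>\<^bsub>R\<^esub>),
      zero = mat n n (\<lambda>(i, j). \<zero>\<^bsub>R\<^esub>),
      add = (\<lambda>A B. mat n n (\<lambda>(i, j). A $$ (i, j) \<oplus>\<^bsub>R\<^esub> B $$ (i, j)))\<rparr>"

lemma (in ring) finsum_swap:
  assumes "finite A" "finite B" "\<And>i j. i \<in> A \<Longrightarrow> j \<in> B \<Longrightarrow> f i j \<in> carrier R"
  shows "(\<Oplus>i\<in>A. \<Oplus>j\<in>B. f i j) = (\<Oplus>j\<in>B. \<Oplus>i\<in>A. f i j)"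
  using assms(1,3)
proof (induction A)
  case empty
  then show ?case by simp
next
  case (insert x F)
  have "(\<Oplus>i\<in>insert x F. \<Oplus>j\<in>B. f i j) = (\<Oplus>j\<in>B. f x j) \<oplus> (\<Oplus>i\<in>F. \<Oplus>j\<in>B. f i j)"
    using insert.hyps insert.prems by (intro finsum_insert) (auto intro!: finsum_closed)
  also have "\<dots> = (\<Oplus>j\<in>B. f x j) \<oplus> (\<Oplus>j\<in>B. \<Oplus>i\<in>F. f i j)"
    using insert.IH insert.prems by auto
  also have "\<dots> = (\<Oplus>j\<in>B. f x j \<oplus> (\<Oplus>i\<in>F. f i j))"
    using insert.prems by (intro finsum_addf[symmetric]) (auto intro!: finsum_closed)
  also have "\<dots> = (\<Oplus>j\<in>B. \<Oplus>i\<in>insert x F. f i j)"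
    using insert.hyps insert.prems
    by (intro finsum_cong' refl finsum_insert[symmetric]) (auto intro!: finsum_closed)
  finally show ?case .
qed

lemma (in ring) ring_upper_triangular_ring: "ring (upper_triangular_ring R n)"
proof -
  let ?T = "upper_triangular_ring R n"
  note def = upper_triangular_ring_def
  have ent: "A $$ (i, j) \<in> carrier R" if "A \<in> carrier ?T" "i < n" "j < n" for A i j
    using that by (simp add: def)
  have dims: "dim_row A = n" "dim_col A = n" if "A \<in> carrier ?T" for A
    using that by (auto simp: def)
  have low: "A $$ (i, j) = \<zero>" if "A \<in> carrier ?T" "i < n" "j < i" for A i j
    using that by (simp add: def)
  have eqI: "A = B"
    if "A \<in> carrier ?T" "B \<in> carrier ?T" "\<And>i j. i < n \<Longrightarrow> j < n \<Longrightarrow> A $$ (i, j) = B $$ (i, j)" for A B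
    using that by (intro eq_matI) (auto simp: dims)
  have mult_ent: "(A \<otimes>\<^bsub>?T\<^esub> B) $$ (i, j) = (\<Oplus>k\<in>{..<n}. A $$ (i, k) \<otimes> B $$ (k, j))"
    and add_ent: "(A \<oplus>\<^bsub>?T\<^esub> B) $$ (i, j) = A $$ (i, j) \<oplus> B $$ (i, j)"
    and one_ent: "\<one>\<^bsub>?T\<^esub> $$ (i, j) = (if i = j then \<one> else \<zero>)" if "i < n" "j < n" for A B i j
    using that by (simp_all add: def)
  have one_closed: "\<one>\<^bsub>?T\<^esub> \<in> carrier ?T"
    by (auto simp: def)
  have add_closed: "A \<oplus>\<^bsub>?T\<^esub> B \<in> carrier ?T" if "A \<in> carrier ?T" "B \<in> carrier ?T" for A B
    using that by (auto simp: def)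
  have mult_closed: "A \<otimes>\<^bsub>?T\<^esub> B \<in> carrier ?T" if A: "A \<in> carrier ?T" and B: "B \<in> carrier ?T" for A B
  proof -
    have "(\<Oplus>k\<in>{..<n}. A $$ (i, k) \<otimes> B $$ (k, j)) = \<zero>" if "i < n" "j < i" for i j
    proof (rule add.finprod_one_eqI)
      fix k assume "k \<in> {..<n}"
      then show "A $$ (i, k) \<otimes> B $$ (k, j) = \<zero>"
        using that ent[OF A, of i k] ent[OF B, of k j] low[OF A, of i k] low[OF B, of k j]
        by (cases "k < i") auto
    qed
    moreover have "(\<Oplus>k\<in>{..<n}. A $$ (i, k) \<otimes> B $$ (k, j)) \<in> carrier R" if "i < n" "j < n" for i j
      using that ent[OF A] ent[OF B] by (intro finsum_closed) auto
    ultimately show ?thesis by (auto simp: def)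
  qed
  have assoc: "(A \<otimes>\<^bsub>?T\<^esub> B) \<otimes>\<^bsub>?T\<^esub> C = A \<otimes>\<^bsub>?T\<^esub> (B \<otimes>\<^bsub>?T\<^esub> C)"
    if A: "A \<in> carrier ?T" and B: "B \<in> carrier ?T" and C: "C \<in> carrier ?T" for A B C
  proof -
    have AB: "A \<otimes>\<^bsub>?T\<^esub> B \<in> carrier ?T" and BC: "B \<otimes>\<^bsub>?T\<^esub> C \<in> carrier ?T"
      using A B C by (simp_all add: mult_closed)
    show ?thesis
    proof (rule eqI)
      fix i j assume ij: "i < n" "j < n"
      have "((A \<otimes>\<^bsub>?T\<^esub> B) \<otimes>\<^bsub>?T\<^esub> C) $$ (i, j)
          = (\<Oplus>k\<in>{..<n}. (\<Oplus>l\<in>{..<n}. A $$ (i, l) \<otimes> B $$ (l, k)) \<otimes> C $$ (k, j))"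
        unfolding mult_ent[OF ij] using ij ent[OF A] ent[OF B] ent[OF C]
        by (intro finsum_cong' refl) (auto intro!: finsum_closed m_closed simp: mult_ent)
      also have "\<dots> = (\<Oplus>k\<in>{..<n}. \<Oplus>l\<in>{..<n}. A $$ (i, l) \<otimes> B $$ (l, k) \<otimes> C $$ (k, j))"
        using ij ent[OF A] ent[OF B] ent[OF C]
        by (intro finsum_cong' refl finsum_ldistr) (auto intro!: finsum_closed)
      also have "\<dots> = (\<Oplus>l\<in>{..<n}. \<Oplus>k\<in>{..<n}. A $$ (i, l) \<otimes> B $$ (l, k) \<otimes> C $$ (k, j))"
        using ij ent[OF A] ent[OF B] ent[OF C] by (intro finsum_swap) auto
      also have "\<dots> = (\<Oplus>l\<in>{..<n}. \<Oplus>k\<in>{..<n}. A $$ (i, l) \<otimes> (B $$ (l, k) \<otimes> C $$ (k, j)))"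
        using ij ent[OF A] ent[OF B] ent[OF C]
        by (intro finsum_cong' refl) (auto intro!: finsum_closed simp: m_assoc)
      also have "\<dots> = (\<Oplus>l\<in>{..<n}. A $$ (i, l) \<otimes> (\<Oplus>k\<in>{..<n}. B $$ (l, k) \<otimes> C $$ (k, j)))"
        using ij ent[OF A] ent[OF B] ent[OF C]
        by (intro finsum_cong' refl finsum_rdistr[symmetric]) (auto intro!: finsum_closed)
      also have "\<dots> = (A \<otimes>\<^bsub>?T\<^esub> (B \<otimes>\<^bsub>?T\<^esub> C)) $$ (i, j)"
        unfolding mult_ent[OF ij] using ij ent[OF A] ent[OF BC]
        by (intro finsum_cong' refl) (auto simp: mult_ent)
      finally show "((A \<otimes>\<^bsub>?T\<^esub> B) \<otimes>\<^bsub>?T\<^esub> C) $$ (i, j) = (A \<otimes>\<^bsub>?T\<^esub> (B \<otimes>\<^bsub>?T\<^esub> C)) $$ (i, j)" .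
    qed (use A B C AB BC mult_closed in auto)
  qed
  have one_l: "\<one>\<^bsub>?T\<^esub> \<otimes>\<^bsub>?T\<^esub> A = A" if A: "A \<in> carrier ?T" for A
  proof (rule eqI)
    fix i j assume ij: "i < n" "j < n"
    have "(\<one>\<^bsub>?T\<^esub> \<otimes>\<^bsub>?T\<^esub> A) $$ (i, j) = (\<Oplus>k\<in>{..<n}. if i = k then A $$ (k, j) else \<zero>)"
      unfolding mult_ent[OF ij] using ij ent[OF A] by (intro finsum_cong' refl) (auto simp: one_ent)
    also have "\<dots> = A $$ (i, j)"
      using ij ent[OF A] by (intro add.finprod_singleton) auto
    finally show "(\<one>\<^bsub>?T\<^esub> \<otimes>\<^bsub>?T\<^esub> A) $$ (i, j) = A $$ (i, j)" .
  qed (use A one_closed mult_closed in auto)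
  have one_r: "A \<otimes>\<^bsub>?T\<^esub> \<one>\<^bsub>?T\<^esub> = A" if A: "A \<in> carrier ?T" for A
  proof (rule eqI)
    fix i j assume ij: "i < n" "j < n"
    have "(A \<otimes>\<^bsub>?T\<^esub> \<one>\<^bsub>?T\<^esub>) $$ (i, j) = (\<Oplus>k\<in>{..<n}. if j = k then A $$ (i, k) else \<zero>)"
      unfolding mult_ent[OF ij] using ij ent[OF A] by (intro finsum_cong' refl) (auto simp: one_ent)
    also have "\<dots> = A $$ (i, j)"
      using ij ent[OF A] by (intro add.finprod_singleton) auto
    finally show "(A \<otimes>\<^bsub>?T\<^esub> \<one>\<^bsub>?T\<^esub>) $$ (i, j) = A $$ (i, j)" .
  qed (use A one_closed mult_closed in auto)
  have distr_r: "(A \<oplus>\<^bsub>?T\<^esub> B) \<otimes>\<^bsub>?T\<^esub> C = A \<otimes>\<^bsub>?T\<^esub> C \<oplus>\<^bsub>?T\<^esub> B \<otimes>\<^bsub>?T\<^esub> C"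
    if A: "A \<in> carrier ?T" and B: "B \<in> carrier ?T" and C: "C \<in> carrier ?T" for A B C
  proof (rule eqI)
    fix i j assume ij: "i < n" "j < n"
    have "((A \<oplus>\<^bsub>?T\<^esub> B) \<otimes>\<^bsub>?T\<^esub> C) $$ (i, j)
        = (\<Oplus>k\<in>{..<n}. A $$ (i, k) \<otimes> C $$ (k, j) \<oplus> B $$ (i, k) \<otimes> C $$ (k, j))"
      unfolding mult_ent[OF ij] using ij ent[OF A] ent[OF B] ent[OF C]
      by (intro finsum_cong' refl) (auto simp: add_ent l_distr)
    also have "\<dots> = (A \<otimes>\<^bsub>?T\<^esub> C \<oplus>\<^bsub>?T\<^esub> B \<otimes>\<^bsub>?T\<^esub> C) $$ (i, j)"
      unfolding add_ent[OF ij] mult_ent[OF ij] using ij ent[OF A] ent[OF B] ent[OF C]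
      by (intro finsum_addf) auto
    finally show "((A \<oplus>\<^bsub>?T\<^esub> B) \<otimes>\<^bsub>?T\<^esub> C) $$ (i, j)
        = (A \<otimes>\<^bsub>?T\<^esub> C \<oplus>\<^bsub>?T\<^esub> B \<otimes>\<^bsub>?T\<^esub> C) $$ (i, j)" .
  qed (use A B C add_closed mult_closed in auto)
  have distr_l: "C \<otimes>\<^bsub>?T\<^esub> (A \<oplus>\<^bsub>?T\<^esub> B) = C \<otimes>\<^bsub>?T\<^esub> A \<oplus>\<^bsub>?T\<^esub> C \<otimes>\<^bsub>?T\<^esub> B"
    if A: "A \<in> carrier ?T" and B: "B \<in> carrier ?T" and C: "C \<in> carrier ?T" for A B C
  proof (rule eqI)
    fix i j assume ij: "i < n" "j < n"
    have "(C \<otimes>\<^bsub>?T\<^esub> (A \<oplus>\<^bsub>?T\<^esub> B)) $$ (i, j)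
        = (\<Oplus>k\<in>{..<n}. C $$ (i, k) \<otimes> A $$ (k, j) \<oplus> C $$ (i, k) \<otimes> B $$ (k, j))"
      unfolding mult_ent[OF ij] using ij ent[OF A] ent[OF B] ent[OF C]
      by (intro finsum_cong' refl) (auto simp: add_ent r_distr)
    also have "\<dots> = (C \<otimes>\<^bsub>?T\<^esub> A \<oplus>\<^bsub>?T\<^esub> C \<otimes>\<^bsub>?T\<^esub> B) $$ (i, j)"
      unfolding add_ent[OF ij] mult_ent[OF ij] using ij ent[OF A] ent[OF B] ent[OF C]
      by (intro finsum_addf) auto
    finally show "(C \<otimes>\<^bsub>?T\<^esub> (A \<oplus>\<^bsub>?T\<^esub> B)) $$ (i, j)
        = (C \<otimes>\<^bsub>?T\<^esub> A \<oplus>\<^bsub>?T\<^esub> C \<otimes>\<^bsub>?T\<^esub> B) $$ (i, j)" .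
  qed (use A B C add_closed mult_closed in auto)
  show ?thesis
  proof (rule ringI)
    show "abelian_group ?T"
    proof (rule abelian_groupI)
      fix A assume A: "A \<in> carrier ?T"
      then show "\<exists>B\<in>carrier ?T. B \<oplus>\<^bsub>?T\<^esub> A = \<zero>\<^bsub>?T\<^esub>"
        by (intro bexI[of _ "mat n n (\<lambda>(i, j). \<ominus> (A $$ (i, j)))"]) (auto simp: def l_neg)
    qed (auto simp: def a_ac intro!: eq_matI)
    show "monoid ?T"
      using mult_closed one_closed assoc one_l one_r by (intro monoidI) auto
  qed (use distr_l distr_r in auto)
qed

end

theory Submission
  imports Defs "HOL-Algebra.Subrings"
begin

text \<open>If \<open>R\<close> is strongly \<open>\<Delta>\<close>-clean, every unit lies in \<open>1 + \<Delta>(R)\<close>, so two decompositions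
  \<open>e + u = f + v\<close> give \<open>e - f \<in> \<Delta>(R)\<close>, which forces \<open>e = f\<close>. Conversely, in a uniquely clean
  commutative ring \<open>1 + u + w\<close> is a unit for all units \<open>u, w\<close>; hence if \<open>a = g + u\<close> is a clean
  decomposition then \<open>a - (1 - g) = (2g - 1) + u\<close>, a sum of two units, lies in \<open>\<Delta>(R)\<close>.

  For a triangular matrix \<open>A\<close> with diagonal entries \<open>a\<^sub>i = e\<^sub>i + d\<^sub>i\<close> put
  \<open>P = \<Prod>\<^sub>i (e\<^sub>i(A - a\<^sub>i) + (1 - e\<^sub>i))\<close> and \<open>Q = \<Prod>\<^sub>i ((1 - e\<^sub>i)(a\<^sub>i - A) + e\<^sub>i)\<close>. The product of the \<open>i\<close>-th factors
  has zero \<open>i\<close>-th diagonal entry, so \<open>PQ = 0\<close>, and on the diagonal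
  \<open>P\<^sub>j\<^sub>j = (1 - e\<^sub>j)v\<close>, \<open>Q\<^sub>j\<^sub>j = e\<^sub>jw\<close> with units \<open>v, w\<close>. Hence \<open>P + Q\<close> is invertible and
  \<open>E = Q(P + Q)\<^sup>-\<^sup>1\<close> is an idempotent with diagonal \<open>e\<^sub>i\<close> that commutes with \<open>A\<close>; matrices whose
  diagonal lies in \<open>\<Delta>(R)\<close> belong to \<open>\<Delta>(T\<^sub>n(R))\<close>.\<close>

lemma ex1_unique: "\<exists>!x. P x \<Longrightarrow> P a \<Longrightarrow> P b \<Longrightarrow> a = b"
  by blast

lemma ring_hom_Units:
  assumes "h \<in> ring_hom S R" "u \<in> Units S"
  shows "h u \<in> Units R"
proof -
  from assms(2) obtain v where v: "u \<in> carrier S" "v \<in> carrier S" "v \<otimes>\<^bsub>S\<^esub> u = \<one>\<^bsub>S\<^esub>" "u \<otimes>\<^bsub>S\<^esub> v = \<one>\<^bsub>S\<^esub>"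
    unfolding Units_def by auto
  have "h v \<otimes>\<^bsub>R\<^esub> h u = \<one>\<^bsub>R\<^esub>" "h u \<otimes>\<^bsub>R\<^esub> h v = \<one>\<^bsub>R\<^esub>"
    using ring_hom_mult[OF assms(1)] ring_hom_one[OF assms(1)] v by metis+
  then show ?thesis using v ring_hom_closed[OF assms(1)] unfolding Units_def by auto
qed

section \<open>Units, idempotents and \<Delta> in a commutative ring\<close>

context cring
begin


lemma UnitsI: "x \<in> carrier R \<Longrightarrow> y \<in> carrier R \<Longrightarrow> x \<otimes> y = \<one> \<Longrightarrow> x \<in> Units R"
  unfolding Units_def using m_comm[of x y] by auto

lemma Units_minus [simp]: "u \<in> Units R \<Longrightarrow> \<ominus> u \<in> Units R"
  using Units_m_closed[OF Units_minus_one_closed, of u] by (simp add: l_minus Units_closed)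

lemma idempotent_if_orthogonal:
  assumes "e \<in> carrier R" "f \<in> carrier R" "e \<oplus> f = \<one>" "e \<otimes> f = \<zero>"
  shows "e \<otimes> e = e"
  using assms by (metis r_distr r_one r_zero m_closed)

text \<open>The pair splits the ring as \<open>eR \<times> fR\<close>, where the element is
  \<open>u\<close> in one component and \<open>v\<close> in the other; its inverse is glued from
  \<open>inv u\<close> and \<open>inv v\<close> in the same way.\<close>

lemma Units_glue:
  assumes e: "e \<in> carrier R" "f \<in> carrier R" "e \<oplus> f = \<one>" "e \<otimes> f = \<zero>"
    and u: "u \<in> Units R" and v: "v \<in> Units R"
  shows "e \<otimes> u \<oplus> f \<otimes> v \<in> Units R"
proof (rule UnitsI)
  have c: "u \<in> carrier R" "v \<in> carrier R" "inv u \<in> carrier R" "inv v \<in> carrier R"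
    using u v by auto
  have fe: "f \<otimes> e = \<zero>" using e by (simp add: m_comm)
  have ee: "e \<otimes> e = e" "f \<otimes> f = f"
    using idempotent_if_orthogonal[of e f] idempotent_if_orthogonal[of f e] e fe
    by (auto simp: a_comm)
  have "(e \<otimes> u \<oplus> f \<otimes> v) \<otimes> (e \<otimes> inv u \<oplus> f \<otimes> inv v) =
     (e \<otimes> e) \<otimes> (u \<otimes> inv u) \<oplus> (e \<otimes> f) \<otimes> (u \<otimes> inv v)
      \<oplus> ((f \<otimes> e) \<otimes> (v \<otimes> inv u) \<oplus> (f \<otimes> f) \<otimes> (v \<otimes> inv v))"
    using e(1,2) c by algebra
  also have "\<dots> = \<one>" using u v e c by (simp add: ee fe)
  finally show "(e \<otimes> u \<oplus> f \<otimes> v) \<otimes> (e \<otimes> inv u \<oplus> f \<otimes> inv v) = \<one>" .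
qed (use e u v in \<open>auto simp: Units_closed\<close>)

lemma idempotents_complement:
  assumes "e \<in> idempotents R"
  shows "e \<in> carrier R" "e \<otimes> e = e" "\<one> \<ominus> e \<in> idempotents R" "e \<oplus> (\<one> \<ominus> e) = \<one>"
    "e \<otimes> (\<one> \<ominus> e) = \<zero>"
proof -
  show e: "e \<in> carrier R" "e \<otimes> e = e" using assms by (auto simp: idempotents_def)
  show "e \<oplus> (\<one> \<ominus> e) = \<one>" using e(1) by algebra
  have "e \<otimes> (\<one> \<ominus> e) = e \<ominus> e \<otimes> e" using e(1) by algebra
  then show 2: "e \<otimes> (\<one> \<ominus> e) = \<zero>" using e by (simp add: a_minus_def r_neg)
  have "(\<one> \<ominus> e) \<otimes> (\<one> \<ominus> e) = \<one> \<ominus> e \<ominus> e \<otimes> (\<one> \<ominus> e)" using e(1) by algebra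
  also have "\<dots> = \<one> \<ominus> e" using 2 e(1) by algebra
  finally show "\<one> \<ominus> e \<in> idempotents R" using e by (auto simp: idempotents_def)
qed

text \<open>This element is \<open>2e - 1\<close>, glued from \<open>1\<close> on \<open>eR\<close>
  and \<open>-1\<close> on the complement.\<close>

lemma Units_two_idempotent_minus_one:
  assumes "e \<in> idempotents R"
  shows "e \<ominus> (\<one> \<ominus> e) \<in> Units R"
proof -
  note e = idempotents_complement[OF assms]
  have "e \<otimes> \<one> \<oplus> (\<one> \<ominus> e) \<otimes> \<ominus> \<one> = e \<ominus> (\<one> \<ominus> e)" using e(1) by algebra
  then show ?thesis
    using Units_glue[of e "\<one> \<ominus> e" \<one> "\<ominus> \<one>"] e by simp
qed

text \<open>The obstruction \<open>e(1 - f)\<close> lives where \<open>e = 1\<close> and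
  \<open>f = 0\<close>, and there \<open>1 - (e - f)\<close> vanishes. Being annihilated by a unit,
  it is zero.\<close>

lemma idempotents_mult_eqI:
  assumes e: "e \<in> idempotents R" and f: "f \<in> idempotents R"
    and u: "\<one> \<ominus> (e \<ominus> f) \<in> Units R"
  shows "e \<otimes> f = e"
proof -
  note ec = idempotents_complement[OF e] and fc = idempotents_complement[OF f]
  let ?u = "\<one> \<ominus> (e \<ominus> f)"
  have "e \<otimes> (\<one> \<ominus> f) \<otimes> ?u = (\<one> \<ominus> f) \<otimes> (e \<otimes> (\<one> \<ominus> e)) \<oplus> e \<otimes> (f \<otimes> (\<one> \<ominus> f))"
    using ec(1) fc(1) by algebra
  also have "\<dots> = \<zero>" using ec(1) fc(1) by (simp add: ec(5) fc(5))
  finally have 0: "e \<otimes> (\<one> \<ominus> f) \<otimes> ?u = \<zero>" .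
  have "e \<otimes> (\<one> \<ominus> f) = e \<otimes> (\<one> \<ominus> f) \<otimes> ?u \<otimes> inv ?u"
    using u ec(1) fc(1) by (simp add: m_assoc)
  also have "\<dots> = \<zero>" using u by (simp only: 0) simp
  finally have "e \<otimes> (\<one> \<ominus> f) = \<zero>" .
  moreover have "e \<otimes> f = e \<ominus> e \<otimes> (\<one> \<ominus> f)" using ec(1) fc(1) by algebra
  ultimately show ?thesis using ec(1) by (simp add: a_minus_def)
qed

lemma DeltaD: "x \<in> Delta R \<Longrightarrow> u \<in> Units R \<Longrightarrow> \<one> \<ominus> x \<otimes> u \<in> Units R"
  by (simp add: Delta_def)

lemma DeltaI:
  "x \<in> carrier R \<Longrightarrow> (\<And>u. u \<in> Units R \<Longrightarrow> \<one> \<ominus> x \<otimes> u \<in> Units R) \<Longrightarrow> x \<in> Delta R"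
  by (simp add: Delta_def)

lemma Delta_closed [simp]: "x \<in> Delta R \<Longrightarrow> x \<in> carrier R"
  by (simp add: Delta_def)

text \<open>Pull out \<open>u\<close>: the sum is \<open>u(1 - x(- inv u))\<close>.\<close>

lemma Units_add_Delta:
  assumes u: "u \<in> Units R" and x: "x \<in> Delta R"
  shows "u \<oplus> x \<in> Units R"
proof -
  have c: "u \<in> carrier R" "x \<in> carrier R" "inv u \<in> carrier R" using u x by auto
  have "u \<otimes> (\<one> \<ominus> x \<otimes> \<ominus> (inv u)) \<in> Units R"
    using u x by (intro Units_m_closed DeltaD) auto
  moreover have "u \<otimes> (\<one> \<ominus> x \<otimes> \<ominus> (inv u)) = u \<oplus> (u \<otimes> inv u) \<otimes> x"
    using c by algebra
  ultimately show ?thesis using u c by simp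
qed

lemma Delta_mult_Units:
  assumes x: "x \<in> Delta R" and u: "u \<in> Units R"
  shows "x \<otimes> u \<in> Delta R"
proof (rule DeltaI)
  show "x \<otimes> u \<in> carrier R" by (intro m_closed Delta_closed Units_closed x u)
  fix v assume v: "v \<in> Units R"
  have "x \<otimes> u \<otimes> v = x \<otimes> (u \<otimes> v)" using Delta_closed[OF x] Units_closed[OF u] Units_closed[OF v]
    by (rule m_assoc)
  with DeltaD[OF x Units_m_closed[OF u v]] show "\<one> \<ominus> x \<otimes> u \<otimes> v \<in> Units R" by simp
qed

lemma Delta_minus [simp]:
  assumes x: "x \<in> Delta R"
  shows "\<ominus> x \<in> Delta R"
  using Delta_mult_Units[OF x Units_minus_one_closed] x by (simp add: r_minus)

text \<open>The unit \<open>1 - xu\<close> stays a unit when the element \<open>-yu\<close> of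
  \<Delta> is added to it.\<close>

lemma Delta_add:
  assumes x: "x \<in> Delta R" and y: "y \<in> Delta R"
  shows "x \<oplus> y \<in> Delta R"
proof -
  have "\<one> \<ominus> (x \<oplus> y) \<otimes> u \<in> Units R" if u: "u \<in> Units R" for u
  proof -
    have c: "u \<in> carrier R" "x \<in> carrier R" "y \<in> carrier R" using u x y by auto
    from Units_add_Delta[OF DeltaD[OF x u] Delta_minus[OF Delta_mult_Units[OF y u]]]
    have "\<one> \<ominus> x \<otimes> u \<oplus> \<ominus> (y \<otimes> u) \<in> Units R" .
    moreover have "\<one> \<ominus> x \<otimes> u \<oplus> \<ominus> (y \<otimes> u) = \<one> \<ominus> (x \<oplus> y) \<otimes> u" using c by algebra
    ultimately show ?thesis by simp
  qed
  then show ?thesis by (rule DeltaI[rotated]) (use x y in simp_all)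
qed

lemma Delta_diff: "x \<in> Delta R \<Longrightarrow> y \<in> Delta R \<Longrightarrow> x \<ominus> y \<in> Delta R"
  unfolding a_minus_def by (intro Delta_add Delta_minus)

section \<open>Strongly \<Delta>-clean versus uniquely clean rings\<close>

text \<open>In \<open>u = e + d\<close> the idempotent \<open>e = u - d\<close> is a unit, hence
  equal to \<open>1\<close>; what remains is \<open>d\<close>.\<close>

lemma Units_minus_one_Delta:
  assumes "strongly_Delta_clean R" and u: "u \<in> Units R"
  shows "u \<ominus> \<one> \<in> Delta R"
proof -
  from assms u obtain e d where e: "e \<in> idempotents R" and d: "d \<in> Delta R" and eq: "u = e \<oplus> d"
    unfolding strongly_Delta_clean_def by blast
  have c: "e \<in> carrier R" "d \<in> carrier R" and ee: "e \<otimes> e = e"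
    using e d by (auto simp: idempotents_def)
  have "e = u \<oplus> \<ominus> d" unfolding eq using c by algebra
  with Units_add_Delta[OF u Delta_minus[OF d]] have "e \<in> Units R" by simp
  then have "e = \<one>" using ee by (metis Units_inv_closed Units_l_inv Units_closed l_one m_assoc)
  moreover have "\<one> \<oplus> d \<ominus> \<one> = d" using c(2) by algebra
  ultimately show ?thesis using d eq by simp
qed

lemma uniquely_clean_if_strongly_Delta_clean:
  assumes S: "strongly_Delta_clean R"
  shows "uniquely_clean R"
  unfolding uniquely_clean_def
proof
  fix a assume a: "a \<in> carrier R"
  from S a obtain e d where e: "e \<in> idempotents R" and d: "d \<in> Delta R" and eq: "a = e \<oplus> d"
    unfolding strongly_Delta_clean_def by blast
  note ec = idempotents_complement[OF e]
  \<comment> \<open>Passing to the complementary idempotent turns \<open>e + d\<close> into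
    \<open>(1 - e) + ((2e - 1) + d)\<close>, whose second summand is a unit plus an element of
    \<Delta>.\<close>
  let ?u = "(e \<ominus> (\<one> \<ominus> e)) \<oplus> d"
  have u: "?u \<in> Units R" by (rule Units_add_Delta[OF Units_two_idempotent_minus_one[OF e] d])
  have "e \<oplus> d = (\<one> \<ominus> e) \<oplus> ?u"
    using ec(1) Delta_closed[OF d] by algebra
  then have ex: "a = (\<one> \<ominus> e) \<oplus> ?u" using eq by simp
  \<comment> \<open>Half of the uniqueness: \<open>f - g = (v - 1) - (u - 1)\<close> lies in
    \<Delta>, which yields \<open>fg = f\<close>. Exchanging the two decompositions yields
    \<open>gf = g\<close>, and commutativity then gives \<open>f = g\<close>.\<close>
  have absorb: "f \<otimes> g = f" if f: "f \<in> idempotents R" and g: "g \<in> idempotents R" and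
    u: "u \<in> Units R" and v: "v \<in> Units R" and eq: "f \<oplus> u = g \<oplus> v" for f g u v
  proof (rule idempotents_mult_eqI[OF f g])
    have c: "f \<in> carrier R" "g \<in> carrier R" "u \<in> carrier R" "v \<in> carrier R"
      using f g u v by (auto simp: idempotents_def)
    have "f \<ominus> g = f \<oplus> u \<ominus> u \<ominus> g" using c by algebra
    also have "\<dots> = g \<oplus> v \<ominus> u \<ominus> g" by (simp only: eq)
    also have "\<dots> = (v \<ominus> \<one>) \<ominus> (u \<ominus> \<one>)" using c by algebra
    finally have "f \<ominus> g \<in> Delta R" using Units_minus_one_Delta[OF S] Delta_diff u v by metis
    from DeltaD[OF this Units_one_closed]
    show "\<one> \<ominus> (f \<ominus> g) \<in> Units R" using c by simp
  qed
  show "\<exists>!p. p \<in> idempotents R \<times> Units R \<and> a = fst p \<oplus> snd p"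
  proof (rule ex_ex1I)
    show "\<exists>p. p \<in> idempotents R \<times> Units R \<and> a = fst p \<oplus> snd p"
      using ex u ec(3) by (intro exI[of _ "(\<one> \<ominus> e, ?u)"]) simp
  next
    fix p q assume pq: "p \<in> idempotents R \<times> Units R \<and> a = fst p \<oplus> snd p"
      "q \<in> idempotents R \<times> Units R \<and> a = fst q \<oplus> snd q"
    then obtain f u g v where p: "p = (f, u)" "q = (g, v)" by (metis prod.exhaust)
    have f: "f \<in> idempotents R" "g \<in> idempotents R" "u \<in> Units R" "v \<in> Units R" "f \<oplus> u = g \<oplus> v"
      using pq p by auto
    have c: "f \<in> carrier R" "g \<in> carrier R" "u \<in> carrier R" "v \<in> carrier R"
      using f by (auto simp: idempotents_def)
    have "f \<otimes> g = f" by (rule absorb[OF f])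
    moreover have "g \<otimes> f = g" by (rule absorb[OF f(2,1,4,3) f(5)[symmetric]])
    ultimately have "f = g" using c by (simp add: m_comm)
    then show "p = q" using f c p by simp
  qed
qed

text \<open>Take a clean decomposition \<open>1 + u + w = f + t\<close>. On \<open>fR\<close> it
  says \<open>u + w = t\<close>, so after division by \<open>t\<close> a unit there is
  \<open>1\<close> plus another unit. Extended by \<open>1\<close> on \<open>(1 - f)R\<close>, this
  violates uniqueness unless \<open>f = 0\<close>, and then the sum is the unit
  \<open>t\<close>.\<close>

lemma one_add_Units_add_Units:
  assumes C: "uniquely_clean R" and u: "u \<in> Units R" and w: "w \<in> Units R"
  shows "\<one> \<oplus> (u \<oplus> w) \<in> Units R"
proof -
  have uw: "u \<in> carrier R" "w \<in> carrier R" using u w by auto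
  then have "\<one> \<oplus> (u \<oplus> w) \<in> carrier R" by simp
  from ex1_implies_ex[OF C[unfolded uniquely_clean_def, rule_format, OF this]]
  obtain f t where f: "f \<in> idempotents R" and t: "t \<in> Units R" and eq: "\<one> \<oplus> (u \<oplus> w) = f \<oplus> t"
    by auto
  note fc = idempotents_complement[OF f]
  have tc: "t \<in> carrier R" "inv t \<in> carrier R" using t by auto
  note c = uw fc(1) tc
  have "f \<otimes> (u \<oplus> w) = f \<otimes> (\<one> \<oplus> (u \<oplus> w)) \<ominus> f" using c by algebra
  also have "\<dots> = f \<otimes> f \<oplus> f \<otimes> t \<ominus> f" unfolding eq using c by algebra
  also have "\<dots> = f \<otimes> t" unfolding fc(2) using c by algebra
  finally have sum: "f \<otimes> (u \<oplus> w) = f \<otimes> t" .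
  \<comment> \<open>\<open>?b = 0 + ?b = f + ?c\<close> are two clean decompositions of the same element.\<close>
  let ?b = "f \<otimes> (u \<otimes> inv t) \<oplus> (\<one> \<ominus> f) \<otimes> \<one>"
  let ?c = "f \<otimes> (\<ominus> (w \<otimes> inv t)) \<oplus> (\<one> \<ominus> f) \<otimes> \<one>"
  have b: "?b \<in> Units R" using fc u t by (intro Units_glue) auto
  have c': "?c \<in> Units R" using fc w t by (intro Units_glue) auto
  have "f = f \<otimes> (u \<oplus> w) \<otimes> inv t" unfolding sum using t c by (simp add: m_assoc)
  then have "f \<oplus> ?c = f \<otimes> (u \<oplus> w) \<otimes> inv t \<oplus> ?c" by simp
  also have "\<dots> = ?b" using c by algebra
  finally have "f \<oplus> ?c = ?b" .
  moreover have "\<zero> \<in> idempotents R" by (simp add: idempotents_def)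
  moreover have "?b \<in> carrier R" by (rule Units_closed[OF b])
  ultimately have "(f, ?c) = (\<zero>, ?b)"
    using f b c' by (intro ex1_unique[OF C[unfolded uniquely_clean_def, rule_format, of ?b]]) auto
  then have "f = \<zero>" by simp
  then show ?thesis using eq t tc by simp
qed

lemma strongly_Delta_clean_if_uniquely_clean:
  assumes C: "uniquely_clean R"
  shows "strongly_Delta_clean R"
  unfolding strongly_Delta_clean_def
proof
  fix a assume a: "a \<in> carrier R"
  from ex1_implies_ex[OF C[unfolded uniquely_clean_def, rule_format, OF this]]
  obtain g u where g: "g \<in> idempotents R" and u: "u \<in> Units R" and eq: "a = g \<oplus> u"
    by auto
  note gc = idempotents_complement[OF g]
  \<comment> \<open>The idempotent of the new decomposition will be \<open>1 - g\<close>, so the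
    remainder is \<open>g + u - (1 - g) = ?w + u\<close>.\<close>
  let ?w = "g \<ominus> (\<one> \<ominus> g)"
  have w: "?w \<in> Units R" by (rule Units_two_idempotent_minus_one[OF g])
  have c: "g \<in> carrier R" "u \<in> carrier R" using gc u by auto
  \<comment> \<open>The element is \<open>1\<close> plus the two units \<open>-?w v\<close> and
    \<open>-uv\<close>; unique cleanness enters through the preceding lemma.\<close>
  have "\<one> \<ominus> (?w \<oplus> u) \<otimes> v \<in> Units R" if v: "v \<in> Units R" for v
  proof -
    have "\<one> \<oplus> (?w \<otimes> \<ominus> v \<oplus> u \<otimes> \<ominus> v) \<in> Units R"
      using C u v w by (intro one_add_Units_add_Units) auto
    moreover have "\<one> \<oplus> (?w \<otimes> \<ominus> v \<oplus> u \<otimes> \<ominus> v) = \<one> \<ominus> (?w \<oplus> u) \<otimes> v"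
      using c Units_closed[OF v] by algebra
    ultimately show ?thesis by simp
  qed
  then have d: "?w \<oplus> u \<in> Delta R" using c by (intro DeltaI) simp_all
  have "g \<oplus> u = (\<one> \<ominus> g) \<oplus> (?w \<oplus> u)" using c by algebra
  then show "\<exists>e \<in> idempotents R. \<exists>d \<in> Delta R. a = e \<oplus> d \<and> e \<otimes> d = d \<otimes> e"
    using gc(3) d eq m_comm[of "\<one> \<ominus> g" "?w \<oplus> u"] Delta_closed[OF d] c
    by (intro bexI[of _ "\<one> \<ominus> g"] bexI[of _ "?w \<oplus> u"] conjI) simp_all
qed

section \<open>Finite products on components of the ring\<close>

text \<open>Since \<open>g\<close> is idempotent, a copy of it can be distributed to every factor,
  so on the component \<open>gR\<close> the product depends only on the factors there.\<close>

lemma idempotent_mult_finprod_cong: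
  assumes g: "g \<in> carrier R" "g \<otimes> g = g"
    and "f \<in> {..<k} \<rightarrow> carrier R" "f' \<in> {..<k} \<rightarrow> carrier R"
    and "\<And>i. i < k \<Longrightarrow> g \<otimes> f i = g \<otimes> f' i"
  shows "g \<otimes> finprod R f {..<k::nat} = g \<otimes> finprod R f' {..<k}"
  using assms(3-)
proof (induction k)
  case (Suc k)
  have c: "f \<in> {..<k} \<rightarrow> carrier R" "f' \<in> {..<k} \<rightarrow> carrier R" "f k \<in> carrier R" "f' k \<in> carrier R"
    using Suc.prems by auto
  have IH: "g \<otimes> finprod R f {..<k} = g \<otimes> finprod R f' {..<k}"
    using Suc by (intro Suc.IH) auto
  have split: "g \<otimes> finprod R h {..<Suc k} = (g \<otimes> h k) \<otimes> (g \<otimes> finprod R h {..<k})"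
    if h: "h \<in> {..<k} \<rightarrow> carrier R" "h k \<in> carrier R" for h
  proof -
    have "finprod R h {..<Suc k} = h k \<otimes> finprod R h {..<k}"
      using h by (simp add: lessThan_Suc)
    moreover have "(g \<otimes> h k) \<otimes> (g \<otimes> finprod R h {..<k}) = (g \<otimes> g) \<otimes> (h k \<otimes> finprod R h {..<k})"
      using g(1) h(2) finprod_closed[OF h(1)] by algebra
    ultimately show ?thesis using g by simp
  qed
  show ?case using split c IH Suc.prems(3)[of k] by simp
qed simp

lemma finprod_Units:
  "(\<And>i. i < k \<Longrightarrow> f i \<in> Units R) \<Longrightarrow> finprod R f {..<k::nat} \<in> Units R"
proof (induction k)
  case (Suc k)
  then have "f \<in> {..<k} \<rightarrow> carrier R" "f k \<in> carrier R" by (auto intro!: Units_closed)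
  then have "finprod R f {..<Suc k} = f k \<otimes> finprod R f {..<k}" by (simp add: lessThan_Suc)
  then show ?case using Suc by auto
qed simp

text \<open>Modulo \<open>M\<close> every factor is \<open>1\<close>. Whenever the product is zero,
  the \<open>X\<close> found here is an inverse of \<open>M\<close>.\<close>

lemma finprod_one_minus_multiple:
  assumes M: "M \<in> carrier R" and "c \<in> {..<k::nat} \<rightarrow> carrier R"
  shows "\<exists>X \<in> carrier R. (\<Otimes>i\<in>{..<k}. \<one> \<ominus> c i \<otimes> M) = \<one> \<ominus> M \<otimes> X"
  using assms(2)
proof (induction k)
  case 0
  have "\<one> = \<one> \<ominus> M \<otimes> \<zero>" using M by algebra
  then show ?case by auto
next
  case (Suc k)
  from Suc.prems have "c \<in> {..<k} \<rightarrow> carrier R" by auto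
  from Suc.IH[OF this] obtain X
    where X: "X \<in> carrier R" "(\<Otimes>i\<in>{..<k}. \<one> \<ominus> c i \<otimes> M) = \<one> \<ominus> M \<otimes> X" ..
  have ck: "c k \<in> carrier R" "(\<lambda>i. \<one> \<ominus> c i \<otimes> M) \<in> {..<k} \<rightarrow> carrier R"
    using Suc.prems M by (auto simp: Pi_iff)
  then have "(\<Otimes>i\<in>{..<Suc k}. \<one> \<ominus> c i \<otimes> M) = (\<one> \<ominus> c k \<otimes> M) \<otimes> (\<one> \<ominus> M \<otimes> X)"
    using M X by (simp add: lessThan_Suc)
  also have "\<dots> = \<one> \<ominus> M \<otimes> (X \<oplus> c k \<ominus> M \<otimes> (c k \<otimes> X))"
    using M X(1) ck(1) by algebra
  finally show ?case by (rule bexI) (use M X(1) ck(1) in simp)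
qed

text \<open>This computes the \<open>j\<close>-th diagonal entry of the matrix \<open>P\<close>. The
  factor at \<open>i = j\<close> is \<open>1 - e j\<close>, which confines the product to the
  component where \<open>e j = 0\<close>; there every factor agrees with a unit.\<close>

lemma finprod_clean_differences:
  assumes e: "\<And>i. i < n \<Longrightarrow> e i \<in> idempotents R" and d: "\<And>i. i < n \<Longrightarrow> d i \<in> Delta R"
    and j: "j < n"
  shows "\<exists>v \<in> Units R.
    (\<Otimes>i\<in>{..<n::nat}. e i \<otimes> ((e j \<oplus> d j) \<ominus> (e i \<oplus> d i)) \<oplus> (\<one> \<ominus> e i)) = (\<one> \<ominus> e j) \<otimes> v"
proof -
  define x where "x i = e i \<otimes> ((e j \<oplus> d j) \<ominus> (e i \<oplus> d i)) \<oplus> (\<one> \<ominus> e i)" for i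
  \<comment> \<open>\<open>y i\<close> is what \<open>x i\<close> becomes when \<open>e j\<close> is
    replaced by \<open>0\<close>: the unit \<open>-1 + (d j - d i)\<close> on the component of
    \<open>e i\<close>, and \<open>1\<close> on its complement.\<close>
  define y where "y i = e i \<otimes> (\<ominus> \<one> \<oplus> (d j \<ominus> d i)) \<oplus> (\<one> \<ominus> e i) \<otimes> \<one>" for i
  note ec = idempotents_complement[OF e] and dc = Delta_closed[OF d]
  have x: "x i \<in> carrier R" if "i < n" for i
    unfolding x_def using ec(1)[OF j] ec(1)[OF that] dc[OF j] dc[OF that] by simp
  have y: "y i \<in> Units R" if "i < n" for i
    unfolding y_def using ec(1,3,4,5)[OF that] d[OF j] d[OF that]
    by (intro Units_glue Units_add_Delta Delta_diff) auto
  have xy: "(\<one> \<ominus> e j) \<otimes> x i = (\<one> \<ominus> e j) \<otimes> y i" if i: "i < n" for i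
  proof -
    note c = ec(1)[OF j] ec(1)[OF i] dc[OF j] dc[OF i]
    have "(e j \<oplus> d j) \<ominus> (e i \<oplus> d i) = (e j \<ominus> e i) \<oplus> (d j \<ominus> d i)" using c by algebra
    moreover have "e i \<otimes> ((e j \<ominus> e i) \<oplus> t)
        = e i \<otimes> (\<ominus> \<one> \<oplus> t) \<oplus> e j \<otimes> e i \<oplus> e i \<otimes> (\<one> \<ominus> e i)" if "t \<in> carrier R" for t
      using c(1,2) that by algebra
    \<comment> \<open>The difference \<open>e j \<otimes> e i\<close> is killed by
      \<open>1 - e j\<close>.\<close>
    ultimately have "x i = y i \<oplus> e j \<otimes> e i"
      unfolding x_def y_def using c by (simp add: ec(5)[OF i] a_ac)
    then have "(\<one> \<ominus> e j) \<otimes> x i = (\<one> \<ominus> e j) \<otimes> y i \<oplus> (e j \<otimes> (\<one> \<ominus> e j)) \<otimes> e i"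
      using c(1,2) Units_closed[OF y[OF i]] by algebra
    then show ?thesis using c Units_closed[OF y[OF i]] by (simp add: ec(5)[OF j])
  qed
  let ?p = "finprod R x {..<n}" and ?v = "finprod R y {..<n}"
  have p: "?p \<in> carrier R" using x by (intro finprod_closed) auto
  have "(\<one> \<ominus> e j) \<otimes> ?p = (\<one> \<ominus> e j) \<otimes> ?v"
    using ec(3)[OF j] x xy Units_closed[OF y]
    by (intro idempotent_mult_finprod_cong) (auto simp: idempotents_def)
  \<comment> \<open>Isolating the factor \<open>x j = 1 - e j\<close>, which is idempotent, shows
    that the product absorbs \<open>1 - e j\<close>.\<close>
  moreover have "?p = (\<one> \<ominus> e j) \<otimes> ?p"
  proof -
    have q: "finprod R x ({..<n} - {j}) \<in> carrier R" using x by (intro finprod_closed) auto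
    have "{..<n} = insert j ({..<n} - {j})" using j by auto
    then have "?p = finprod R x (insert j ({..<n} - {j}))" by simp
    also have "\<dots> = x j \<otimes> finprod R x ({..<n} - {j})"
      using x j by (intro finprod_insert) auto
    also have "x j = \<one> \<ominus> e j" unfolding x_def using ec(1)[OF j] dc[OF j] by algebra
    finally have "?p = (\<one> \<ominus> e j) \<otimes> finprod R x ({..<n} - {j})" .
    moreover have "(\<one> \<ominus> e j) \<otimes> (\<one> \<ominus> e j) = \<one> \<ominus> e j"
      using ec(3)[OF j] by (simp add: idempotents_def)
    ultimately show ?thesis using q ec(1)[OF j]
      by (metis m_assoc minus_closed one_closed)
  qed
  ultimately have "?p = (\<one> \<ominus> e j) \<otimes> ?v" by simp
  moreover have "?v \<in> Units R" using y by (rule finprod_Units)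
  ultimately show ?thesis unfolding x_def by blast
qed

end

section \<open>Commutative rings with a family of diagonal maps\<close>

text \<open>In the application \<open>\<delta> i\<close> reads off the \<open>i\<close>-th diagonal entry, \<open>\<iota>\<close> embeds scalar matrices, and the last
  assumption replaces the Cayley-Hamilton theorem.\<close>

locale diagonal_cring = K: cring K + R: cring R
  for K :: "('k, 'l) ring_scheme" and R :: "('a, 'm) ring_scheme" +
  fixes n :: nat and \<delta> :: "nat \<Rightarrow> 'k \<Rightarrow> 'a" and \<iota> :: "'a \<Rightarrow> 'k"
  assumes \<delta>_hom: "i < n \<Longrightarrow> \<delta> i \<in> ring_hom K R"
    and \<iota>_closed: "r \<in> carrier R \<Longrightarrow> \<iota> r \<in> carrier K"
    and \<delta>_\<iota>: "r \<in> carrier R \<Longrightarrow> i < n \<Longrightarrow> \<delta> i (\<iota> r) = r"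
    and finprod_zero: "(\<And>i. i < n \<Longrightarrow> B i \<in> carrier K) \<Longrightarrow>
      (\<And>i. i < n \<Longrightarrow> \<delta> i (B i) = \<zero>\<^bsub>R\<^esub>) \<Longrightarrow> finprod K B {..<n} = \<zero>\<^bsub>K\<^esub>"
begin

lemma \<delta>_cring: "i < n \<Longrightarrow> ring_hom_cring K R (\<delta> i)"
  using \<delta>_hom by (simp add: ring_hom_cring_def ring_hom_cring_axioms_def K.is_cring R.is_cring)

lemmas \<delta>_simps = ring_hom_mult[OF \<delta>_hom] ring_hom_add[OF \<delta>_hom] ring_hom_one[OF \<delta>_hom]
  ring_hom_closed[OF \<delta>_hom] \<delta>_\<iota> \<iota>_closed ring_hom_cring.hom_a_inv[OF \<delta>_cring]

text \<open>With \<open>?c i\<close> the scalar inverse to the \<open>i\<close>-th diagonal entry of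
  \<open>M\<close>, the factor \<open>1 - ?c i M\<close> has zero \<open>i\<close>-th diagonal
  entry. So the product of these factors vanishes, and expanding it as \<open>1 - MX\<close>
  exhibits \<open>X\<close> as the inverse.\<close>

lemma Units_if_diagonal_Units:
  assumes M: "M \<in> carrier K" and u: "\<And>i. i < n \<Longrightarrow> \<delta> i M \<in> Units R"
  shows "M \<in> Units K"
proof -
  let ?c = "\<lambda>i. \<iota> (inv\<^bsub>R\<^esub> (\<delta> i M))"
  have c: "?c i \<in> carrier K" if "i < n" for i using u that \<iota>_closed by auto
  have "(\<Otimes>\<^bsub>K\<^esub>i\<in>{..<n}. \<one>\<^bsub>K\<^esub> \<ominus>\<^bsub>K\<^esub> ?c i \<otimes>\<^bsub>K\<^esub> M) = \<zero>\<^bsub>K\<^esub>"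
  proof (rule finprod_zero)
    fix i assume i: "i < n"
    show "\<one>\<^bsub>K\<^esub> \<ominus>\<^bsub>K\<^esub> ?c i \<otimes>\<^bsub>K\<^esub> M \<in> carrier K" using c[OF i] M by simp
    have inv: "inv\<^bsub>R\<^esub> (\<delta> i M) \<in> carrier R" "inv\<^bsub>R\<^esub> (\<delta> i M) \<otimes>\<^bsub>R\<^esub> \<delta> i M = \<one>\<^bsub>R\<^esub>"
      using u[OF i] by auto
    show "\<delta> i (\<one>\<^bsub>K\<^esub> \<ominus>\<^bsub>K\<^esub> ?c i \<otimes>\<^bsub>K\<^esub> M) = \<zero>\<^bsub>R\<^esub>"
      using c[OF i] M i inv by (simp add: a_minus_def \<delta>_simps R.r_neg)
  qed
  moreover obtain X where X: "X \<in> carrier K"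
    "(\<Otimes>\<^bsub>K\<^esub>i\<in>{..<n}. \<one>\<^bsub>K\<^esub> \<ominus>\<^bsub>K\<^esub> ?c i \<otimes>\<^bsub>K\<^esub> M) = \<one>\<^bsub>K\<^esub> \<ominus>\<^bsub>K\<^esub> M \<otimes>\<^bsub>K\<^esub> X"
    using K.finprod_one_minus_multiple[OF M, of ?c n] c by auto
  ultimately have "\<one>\<^bsub>K\<^esub> \<ominus>\<^bsub>K\<^esub> M \<otimes>\<^bsub>K\<^esub> X = \<zero>\<^bsub>K\<^esub>" by simp
  then have "M \<otimes>\<^bsub>K\<^esub> X = \<one>\<^bsub>K\<^esub>"
    using M X(1) by (metis K.add.inv_solve_right a_minus_def K.l_zero K.m_closed K.one_closed K.zero_closed)
  then show ?thesis using M X(1) K.UnitsI by blast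
qed

text \<open>\<open>finprod K F {..<n}\<close> is the \<open>P\<close> of the overview. The data are
  kept arbitrary so that a second application can produce \<open>Q\<close>.\<close>

lemma diagonal_polynomial:
  assumes A: "A \<in> carrier K"
    and e: "\<And>i. i < n \<Longrightarrow> e i \<in> idempotents R" and d: "\<And>i. i < n \<Longrightarrow> d i \<in> Delta R"
    and \<delta>A: "\<And>i. i < n \<Longrightarrow> \<delta> i A = e i \<oplus>\<^bsub>R\<^esub> d i"
  obtains F where "\<And>i. i < n \<Longrightarrow> F i \<in> carrier K"
    "\<And>i. i < n \<Longrightarrow> \<delta> i (F i) = \<one>\<^bsub>R\<^esub> \<ominus>\<^bsub>R\<^esub> e i"
    "\<And>j. j < n \<Longrightarrow> \<exists>v \<in> Units R. \<delta> j (finprod K F {..<n}) = (\<one>\<^bsub>R\<^esub> \<ominus>\<^bsub>R\<^esub> e j) \<otimes>\<^bsub>R\<^esub> v"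
proof -
  define F where "F i = \<iota> (e i) \<otimes>\<^bsub>K\<^esub> (A \<ominus>\<^bsub>K\<^esub> \<iota> (e i \<oplus>\<^bsub>R\<^esub> d i)) \<oplus>\<^bsub>K\<^esub> \<iota> (\<one>\<^bsub>R\<^esub> \<ominus>\<^bsub>R\<^esub> e i)" for i
  note ec = R.idempotents_complement(1)[OF e] and dc = R.Delta_closed[OF d]
  have F: "F i \<in> carrier K" if "i < n" for i
    unfolding F_def using A ec[OF that] dc[OF that] by (simp add: \<iota>_closed)
  have \<delta>F: "\<delta> j (F i) = e i \<otimes>\<^bsub>R\<^esub> ((e j \<oplus>\<^bsub>R\<^esub> d j) \<ominus>\<^bsub>R\<^esub> (e i \<oplus>\<^bsub>R\<^esub> d i)) \<oplus>\<^bsub>R\<^esub> (\<one>\<^bsub>R\<^esub> \<ominus>\<^bsub>R\<^esub> e i)"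
    if "i < n" "j < n" for i j
    unfolding F_def a_minus_def using A ec[OF that(1)] dc[OF that(1)] that(2)
    by (simp add: \<delta>_simps \<delta>A)
  show ?thesis
  proof (rule that[of F, OF F])
    fix i assume i: "i < n"
    show "\<delta> i (F i) = \<one>\<^bsub>R\<^esub> \<ominus>\<^bsub>R\<^esub> e i"
      unfolding \<delta>F[OF i i] using ec[OF i] dc[OF i] by algebra
    \<comment> \<open>As \<open>\<delta> i\<close> is a ring homomorphism, the diagonal entry of the
      product is the product of scalars evaluated in
      \<open>finprod_clean_differences\<close>.\<close>
    have "\<delta> i (finprod K F {..<n}) = finprod R (\<delta> i \<circ> F) {..<n}"
      using F by (intro ring_hom_cring.hom_finprod[OF \<delta>_cring[OF i]]) auto
    also have "\<dots> = (\<Otimes>\<^bsub>R\<^esub>k\<in>{..<n}. e k \<otimes>\<^bsub>R\<^esub> ((e i \<oplus>\<^bsub>R\<^esub> d i) \<ominus>\<^bsub>R\<^esub> (e k \<oplus>\<^bsub>R\<^esub> d k)) \<oplus>\<^bsub>R\<^esub> (\<one>\<^bsub>R\<^esub> \<ominus>\<^bsub>R\<^esub> e k))"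
      using \<delta>F i ec dc by (intro R.finprod_cong') auto
    finally show "\<exists>v \<in> Units R. \<delta> i (finprod K F {..<n}) = (\<one>\<^bsub>R\<^esub> \<ominus>\<^bsub>R\<^esub> e i) \<otimes>\<^bsub>R\<^esub> v"
      using R.finprod_clean_differences[of n e d i] e d i by simp
  qed
qed

lemma lift_diagonal_idempotents:
  assumes A: "A \<in> carrier K"
    and e: "\<And>i. i < n \<Longrightarrow> e i \<in> idempotents R" and d: "\<And>i. i < n \<Longrightarrow> d i \<in> Delta R"
    and \<delta>A: "\<And>i. i < n \<Longrightarrow> \<delta> i A = e i \<oplus>\<^bsub>R\<^esub> d i"
  shows "\<exists>E \<in> idempotents K. \<forall>i<n. \<delta> i E = e i"
proof -
  note ec = R.idempotents_complement[OF e] and dc = R.Delta_closed[OF d]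
  have cc: "\<one>\<^bsub>R\<^esub> \<ominus>\<^bsub>R\<^esub> (\<one>\<^bsub>R\<^esub> \<ominus>\<^bsub>R\<^esub> e i) = e i" if "i < n" for i
    using ec(1)[OF that] by algebra
  obtain F where F: "\<And>i. i < n \<Longrightarrow> F i \<in> carrier K"
    "\<And>i. i < n \<Longrightarrow> \<delta> i (F i) = \<one>\<^bsub>R\<^esub> \<ominus>\<^bsub>R\<^esub> e i"
    "\<And>j. j < n \<Longrightarrow> \<exists>v \<in> Units R. \<delta> j (finprod K F {..<n}) = (\<one>\<^bsub>R\<^esub> \<ominus>\<^bsub>R\<^esub> e j) \<otimes>\<^bsub>R\<^esub> v"
    using diagonal_polynomial[of A e d] A e d \<delta>A by blast
  \<comment> \<open>Preparation for \<open>Q\<close>: with \<open>1 - A\<close>,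
    \<open>1 - e i\<close> and \<open>-d i\<close> as data, the factors constructed above become
    \<open>(1 - e i)(a i - A) + e i\<close>, where \<open>a i = e i + d i\<close>.\<close>
  have \<delta>A': "\<delta> i (\<one>\<^bsub>K\<^esub> \<ominus>\<^bsub>K\<^esub> A) = (\<one>\<^bsub>R\<^esub> \<ominus>\<^bsub>R\<^esub> e i) \<oplus>\<^bsub>R\<^esub> \<ominus>\<^bsub>R\<^esub> d i" if i: "i < n" for i
  proof -
    have "\<delta> i (\<one>\<^bsub>K\<^esub> \<ominus>\<^bsub>K\<^esub> A) = \<one>\<^bsub>R\<^esub> \<ominus>\<^bsub>R\<^esub> (e i \<oplus>\<^bsub>R\<^esub> d i)"
      unfolding a_minus_def using A i by (simp add: \<delta>_simps \<delta>A)
    also have "\<dots> = (\<one>\<^bsub>R\<^esub> \<ominus>\<^bsub>R\<^esub> e i) \<oplus>\<^bsub>R\<^esub> \<ominus>\<^bsub>R\<^esub> d i" using ec(1)[OF i] dc[OF i] by algebra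
    finally show ?thesis .
  qed
  obtain G where G: "\<And>i. i < n \<Longrightarrow> G i \<in> carrier K"
    "\<And>i. i < n \<Longrightarrow> \<delta> i (G i) = \<one>\<^bsub>R\<^esub> \<ominus>\<^bsub>R\<^esub> (\<one>\<^bsub>R\<^esub> \<ominus>\<^bsub>R\<^esub> e i)"
    "\<And>j. j < n \<Longrightarrow> \<exists>v \<in> Units R. \<delta> j (finprod K G {..<n}) = (\<one>\<^bsub>R\<^esub> \<ominus>\<^bsub>R\<^esub> (\<one>\<^bsub>R\<^esub> \<ominus>\<^bsub>R\<^esub> e j)) \<otimes>\<^bsub>R\<^esub> v"
    using diagonal_polynomial[of "\<one>\<^bsub>K\<^esub> \<ominus>\<^bsub>K\<^esub> A" "\<lambda>i. \<one>\<^bsub>R\<^esub> \<ominus>\<^bsub>R\<^esub> e i" "\<lambda>i. \<ominus>\<^bsub>R\<^esub> d i"]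
      A ec(3) R.Delta_minus[OF d] \<delta>A' by (metis (no_types, lifting) K.minus_closed K.one_closed)
  let ?P = "finprod K F {..<n}" and ?Q = "finprod K G {..<n}"
  let ?M = "?P \<oplus>\<^bsub>K\<^esub> ?Q"
  have PQ: "?P \<in> carrier K" "?Q \<in> carrier K" using F(1) G(1) by (auto intro!: K.finprod_closed)
  have "?P \<otimes>\<^bsub>K\<^esub> ?Q = (\<Otimes>\<^bsub>K\<^esub>i\<in>{..<n}. F i \<otimes>\<^bsub>K\<^esub> G i)"
    using F(1) G(1) by (intro K.finprod_multf[symmetric]) auto
  also have "\<dots> = \<zero>\<^bsub>K\<^esub>"
  proof (rule finprod_zero)
    fix i assume i: "i < n"
    show "F i \<otimes>\<^bsub>K\<^esub> G i \<in> carrier K" using F(1) G(1) i by simp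
    show "\<delta> i (F i \<otimes>\<^bsub>K\<^esub> G i) = \<zero>\<^bsub>R\<^esub>"
      using i F(1,2) G(1,2) ec(1,5)[OF i] by (simp add: \<delta>_simps cc R.m_comm)
  qed
  finally have PQ0: "?P \<otimes>\<^bsub>K\<^esub> ?Q = \<zero>\<^bsub>K\<^esub>" .
  \<comment> \<open>At each diagonal position \<open>?M\<close> is glued from the unit
    \<open>w\<close> on the component of \<open>e j\<close> and the unit \<open>v\<close> on the
    complement; multiplication by \<open>e j\<close> keeps only the contribution of
    \<open>?Q\<close>.\<close>
  have \<delta>M: "\<delta> j ?M \<in> Units R \<and> e j \<otimes>\<^bsub>R\<^esub> \<delta> j ?M = \<delta> j ?Q" if j: "j < n" for j
  proof -
    obtain v w where v: "v \<in> Units R" "\<delta> j ?P = (\<one>\<^bsub>R\<^esub> \<ominus>\<^bsub>R\<^esub> e j) \<otimes>\<^bsub>R\<^esub> v"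
      and w: "w \<in> Units R" "\<delta> j ?Q = e j \<otimes>\<^bsub>R\<^esub> w"
      using F(3)[OF j] G(3)[OF j] cc[OF j] by auto
    note c = ec(1)[OF j] R.Units_closed[OF v(1)] R.Units_closed[OF w(1)]
    have M: "\<delta> j ?M = e j \<otimes>\<^bsub>R\<^esub> w \<oplus>\<^bsub>R\<^esub> (\<one>\<^bsub>R\<^esub> \<ominus>\<^bsub>R\<^esub> e j) \<otimes>\<^bsub>R\<^esub> v"
      using PQ j v w c by (simp add: \<delta>_simps R.a_comm)
    have "e j \<otimes>\<^bsub>R\<^esub> \<delta> j ?M = (e j \<otimes>\<^bsub>R\<^esub> e j) \<otimes>\<^bsub>R\<^esub> w \<oplus>\<^bsub>R\<^esub> (e j \<otimes>\<^bsub>R\<^esub> (\<one>\<^bsub>R\<^esub> \<ominus>\<^bsub>R\<^esub> e j)) \<otimes>\<^bsub>R\<^esub> v"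
      unfolding M using c by algebra
    also have "\<dots> = \<delta> j ?Q" using c by (simp add: ec(2,5)[OF j] w(2))
    finally show ?thesis using M R.Units_glue[of "e j" "\<one>\<^bsub>R\<^esub> \<ominus>\<^bsub>R\<^esub> e j" w v] ec(1,4,5)[OF j] v(1) w(1) by simp
  qed
  have MU: "?M \<in> Units K" using PQ \<delta>M by (intro Units_if_diagonal_Units) auto
  let ?E = "?Q \<otimes>\<^bsub>K\<^esub> inv\<^bsub>K\<^esub> ?M"
  have I: "inv\<^bsub>K\<^esub> ?M \<in> carrier K" using MU by simp
  \<comment> \<open>Because \<open>?P ?Q = 0\<close>, the square of \<open>?Q\<close> equals
    \<open>?Q (?P + ?Q)\<close>; dividing twice by \<open>?M\<close> makes \<open>?E\<close>
    idempotent.\<close>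
  have QQ: "?Q \<otimes>\<^bsub>K\<^esub> ?Q = ?Q \<otimes>\<^bsub>K\<^esub> ?M"
    using PQ PQ0 by (simp add: K.r_distr K.m_comm)
  have "?E \<otimes>\<^bsub>K\<^esub> ?E = (?Q \<otimes>\<^bsub>K\<^esub> ?Q) \<otimes>\<^bsub>K\<^esub> (inv\<^bsub>K\<^esub> ?M \<otimes>\<^bsub>K\<^esub> inv\<^bsub>K\<^esub> ?M)"
    using PQ I by (simp add: K.m_ac)
  also have "\<dots> = ?Q \<otimes>\<^bsub>K\<^esub> (?M \<otimes>\<^bsub>K\<^esub> inv\<^bsub>K\<^esub> ?M) \<otimes>\<^bsub>K\<^esub> inv\<^bsub>K\<^esub> ?M"
    using PQ I by (simp only: QQ K.m_assoc K.m_closed K.a_closed)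
  also have "\<dots> = ?E" using PQ MU by simp
  finally have E: "?E \<in> idempotents K" using PQ I by (simp add: idempotents_def)
  moreover have "\<delta> j ?E = e j" if j: "j < n" for j
  proof -
    have Ec: "\<delta> j ?E \<in> carrier R" using E j by (simp add: \<delta>_simps idempotents_def)
    \<comment> \<open>The entry of \<open>?E\<close> is compared with \<open>e j\<close> after
      multiplication by \<open>\<delta> j ?M\<close>: both products equal
      \<open>\<delta> j ?Q\<close>, and the unit cancels.\<close>
    have "?E \<otimes>\<^bsub>K\<^esub> ?M = ?Q" using PQ I MU by (simp add: K.m_assoc)
    then have "\<delta> j ?E \<otimes>\<^bsub>R\<^esub> \<delta> j ?M = \<delta> j ?Q"
      using \<delta>_simps(1)[OF j, of ?E ?M] PQ I by simp
    also have "\<dots> = e j \<otimes>\<^bsub>R\<^esub> \<delta> j ?M" using \<delta>M[OF j] by simp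
    finally have "\<delta> j ?M \<otimes>\<^bsub>R\<^esub> \<delta> j ?E = \<delta> j ?M \<otimes>\<^bsub>R\<^esub> e j"
      using Ec ec(1)[OF j] \<delta>M[OF j] by (metis R.Units_closed R.m_comm)
    then show ?thesis using R.Units_l_cancel \<delta>M[OF j] Ec ec(1)[OF j] by metis
  qed
  ultimately show ?thesis by blast
qed

end

section \<open>The double centralizer of an element\<close>

text \<open>The double centralizer is a commutative subring that contains \<open>a\<close>, the centre, and the inverses of its
  units, so all constructions from one matrix can be carried out in a \<open>cring\<close>.\<close>

definition double_centralizer :: "('a, 'm) ring_scheme \<Rightarrow> 'a \<Rightarrow> 'a set" where
  "double_centralizer S a = {x \<in> carrier S.
    \<forall>y \<in> carrier S. y \<otimes>\<^bsub>S\<^esub> a = a \<otimes>\<^bsub>S\<^esub> y \<longrightarrow> x \<otimes>\<^bsub>S\<^esub> y = y \<otimes>\<^bsub>S\<^esub> x}"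

context ring
begin

lemma double_centralizerD:
  assumes "x \<in> double_centralizer R a"
  shows "x \<in> carrier R" "y \<in> carrier R \<Longrightarrow> y \<otimes> a = a \<otimes> y \<Longrightarrow> x \<otimes> y = y \<otimes> x"
  using assms by (auto simp: double_centralizer_def)

lemma double_centralizer_self: "a \<in> carrier R \<Longrightarrow> a \<in> double_centralizer R a"
  by (auto simp: double_centralizer_def)

text \<open>Commuting with a fixed element is preserved by the ring operations, which gives a
  subring. Each member commutes with \<open>a\<close>, since \<open>a\<close> commutes with itself,
  and is therefore among the elements with which all other members commute.\<close>

lemma cring_double_centralizer:
  assumes a: "a \<in> carrier R"
  shows "cring (R\<lparr>carrier := double_centralizer R a\<rparr>)"
proof -
  let ?D = "double_centralizer R a"
  have "subring ?D R"
  proof (rule subringI)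
    fix x assume x: "x \<in> ?D"
    show "\<ominus> x \<in> ?D"
      using double_centralizerD[OF x] by (auto simp: double_centralizer_def l_minus r_minus)
    fix y assume y: "y \<in> ?D"
    note xy = double_centralizerD[OF x] double_centralizerD[OF y]
    show "x \<oplus> y \<in> ?D" using xy by (auto simp: double_centralizer_def l_distr r_distr)
    have "x \<otimes> y \<otimes> z = z \<otimes> (x \<otimes> y)" if z: "z \<in> carrier R" "z \<otimes> a = a \<otimes> z" for z
    proof -
      have "x \<otimes> y \<otimes> z = x \<otimes> z \<otimes> y" using xy(1,3) z(1) xy(4)[OF z] by (simp add: m_assoc)
      also have "\<dots> = z \<otimes> (x \<otimes> y)" using xy(1,3) z(1) xy(2)[OF z] by (simp add: m_assoc)
      finally show ?thesis .
    qed
    then show "x \<otimes> y \<in> ?D" using xy(1,3) by (auto simp: double_centralizer_def)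
  qed (auto simp: double_centralizer_def)
  then have "subcring ?D R"
  proof (rule subcringI)
    fix x y assume x: "x \<in> ?D" and y: "y \<in> ?D"
    have "y \<otimes> a = a \<otimes> y" using double_centralizerD(2)[OF y a] by simp
    then show "x \<otimes> y = y \<otimes> x" using double_centralizerD[OF x] double_centralizerD(1)[OF y] by simp
  qed
  then show ?thesis using subcring_iff[of ?D] by (auto simp: double_centralizer_def)
qed

end

section \<open>Triangular matrices over a commutative ring\<close>

definition scalar_mat :: "('a, 'm) ring_scheme \<Rightarrow> nat \<Rightarrow> 'a \<Rightarrow> 'a mat" where
  "scalar_mat R n r = mat n n (\<lambda>(i, j). if i = j then r else \<zero>\<^bsub>R\<^esub>)"

locale cring_triangular = cring R for R :: "('a, 'm) ring_scheme" (structure) + fixes n :: nat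
begin

abbreviation T where "T \<equiv> upper_triangular_ring R n"

sublocale T: ring T by (rule ring_upper_triangular_ring)

lemma carrier_T_D:
  assumes "A \<in> carrier T"
  shows "A \<in> carrier_mat n n" "i < n \<Longrightarrow> j < n \<Longrightarrow> A $$ (i, j) \<in> carrier R"
    "i < n \<Longrightarrow> j < i \<Longrightarrow> A $$ (i, j) = \<zero>"
  using assms by (auto simp: upper_triangular_ring_def)

lemma T_eqI:
  assumes "A \<in> carrier T" "B \<in> carrier T" "\<And>i j. i < n \<Longrightarrow> j < n \<Longrightarrow> A $$ (i, j) = B $$ (i, j)"
  shows "A = B"
  using carrier_T_D(1)[OF assms(1)] carrier_T_D(1)[OF assms(2)] assms(3) by (intro eq_matI) auto

lemma T_entry:
  assumes "i < n" "j < n"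
  shows "(A \<otimes>\<^bsub>T\<^esub> B) $$ (i, j) = (\<Oplus>k\<in>{..<n}. A $$ (i, k) \<otimes> B $$ (k, j))"
    "(A \<oplus>\<^bsub>T\<^esub> B) $$ (i, j) = A $$ (i, j) \<oplus> B $$ (i, j)"
    "\<one>\<^bsub>T\<^esub> $$ (i, j) = (if i = j then \<one> else \<zero>)"
    "\<zero>\<^bsub>T\<^esub> $$ (i, j) = \<zero>"
  using assms by (simp_all add: upper_triangular_ring_def)

lemma finsum_single:
  assumes "i < n" "f \<in> {..<n} \<rightarrow> carrier R" "\<And>k. k < n \<Longrightarrow> k \<noteq> i \<Longrightarrow> f k = \<zero>"
  shows "(\<Oplus>k\<in>{..<n}. f k) = f i"
proof -
  have "(\<Oplus>k\<in>{..<n}. f k) = (\<Oplus>k\<in>{..<n}. if i = k then f k else \<zero>)"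
    using assms by (intro finsum_cong') auto
  also have "\<dots> = f i" using assms by (intro add.finprod_singleton) auto
  finally show ?thesis .
qed

text \<open>In the sum for the entry \<open>(i, i)\<close> of a product, every term with
  \<open>k \<noteq> i\<close> has a factor below the diagonal: the first if \<open>k < i\<close>,
  the second if \<open>k > i\<close>.\<close>

lemma diagonal_hom:
  assumes i: "i < n"
  shows "(\<lambda>A. A $$ (i, i)) \<in> ring_hom T R"
proof (rule ring_hom_memI)
  fix A B assume A: "A \<in> carrier T" and B: "B \<in> carrier T"
  note a = carrier_T_D[OF A] and b = carrier_T_D[OF B]
  show "(A \<otimes>\<^bsub>T\<^esub> B) $$ (i, i) = A $$ (i, i) \<otimes> B $$ (i, i)"
    unfolding T_entry[OF i i]
  proof (rule finsum_single[OF i])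
    fix k assume k: "k < n" "k \<noteq> i"
    then show "A $$ (i, k) \<otimes> B $$ (k, i) = \<zero>"
      using i a(2,3)[of i k] b(2,3)[of k i] by (cases "k < i") auto
  qed (use a b i in auto)
qed (use i carrier_T_D in \<open>auto simp: T_entry\<close>)

lemma scalar_mat_closed: "r \<in> carrier R \<Longrightarrow> scalar_mat R n r \<in> carrier T"
  by (auto simp: upper_triangular_ring_def scalar_mat_def)

lemma scalar_mat_mult:
  assumes r: "r \<in> carrier R" and A: "A \<in> carrier T" and ij: "i < n" "j < n"
  shows "(scalar_mat R n r \<otimes>\<^bsub>T\<^esub> A) $$ (i, j) = r \<otimes> A $$ (i, j)"
    "(A \<otimes>\<^bsub>T\<^esub> scalar_mat R n r) $$ (i, j) = r \<otimes> A $$ (i, j)"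
proof -
  note a = carrier_T_D[OF A]
  have "(scalar_mat R n r \<otimes>\<^bsub>T\<^esub> A) $$ (i, j) = scalar_mat R n r $$ (i, i) \<otimes> A $$ (i, j)"
    unfolding T_entry[OF ij] using r a ij by (intro finsum_single) (auto simp: scalar_mat_def)
  then show "(scalar_mat R n r \<otimes>\<^bsub>T\<^esub> A) $$ (i, j) = r \<otimes> A $$ (i, j)" using ij by (simp add: scalar_mat_def)
  have "(A \<otimes>\<^bsub>T\<^esub> scalar_mat R n r) $$ (i, j) = A $$ (i, j) \<otimes> scalar_mat R n r $$ (j, j)"
    unfolding T_entry[OF ij] using r a ij by (intro finsum_single) (auto simp: scalar_mat_def)
  then show "(A \<otimes>\<^bsub>T\<^esub> scalar_mat R n r) $$ (i, j) = r \<otimes> A $$ (i, j)"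
    using ij a r by (simp add: scalar_mat_def m_comm)
qed

text \<open>This puts the scalar matrices into every double centralizer, as the map
  \<open>\<iota>\<close> of \<open>diagonal_cring\<close> requires.\<close>

lemma scalar_mat_central:
  assumes "r \<in> carrier R" "A \<in> carrier T"
  shows "scalar_mat R n r \<otimes>\<^bsub>T\<^esub> A = A \<otimes>\<^bsub>T\<^esub> scalar_mat R n r"
  using assms by (intro T_eqI T.m_closed scalar_mat_closed) (simp_all add: scalar_mat_mult)

lemma scalar_mat_Units:
  assumes u: "u \<in> Units R"
  shows "scalar_mat R n u \<in> Units T"
proof -
  have c: "u \<in> carrier R" "inv u \<in> carrier R" using u by auto
  have "scalar_mat R n u \<otimes>\<^bsub>T\<^esub> scalar_mat R n (inv u) = \<one>\<^bsub>T\<^esub>"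
    using c u by (intro T_eqI T.m_closed scalar_mat_closed)
      (simp_all add: scalar_mat_mult scalar_mat_closed T_entry(3), simp_all add: scalar_mat_def)
  then show ?thesis
    using scalar_mat_closed[OF c(1)] scalar_mat_closed[OF c(2)]
      scalar_mat_central[OF c(1) scalar_mat_closed[OF c(2)]]
    unfolding Units_def by auto
qed

text \<open>Each factor clears one more column: the product of the first \<open>k\<close> factors
  has its first \<open>k\<close> columns zero.\<close>

lemma finprod_triangular_eq_zero:
  assumes a: "a \<in> carrier T"
    and B: "\<And>i. i < n \<Longrightarrow> B i \<in> double_centralizer T a"
    and diag: "\<And>i. i < n \<Longrightarrow> B i $$ (i, i) = \<zero>"
  shows "finprod (T\<lparr>carrier := double_centralizer T a\<rparr>) B {..<n} = \<zero>\<^bsub>T\<^esub>"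
proof -
  let ?K = "T\<lparr>carrier := double_centralizer T a\<rparr>"
  interpret K: cring ?K by (rule T.cring_double_centralizer[OF a])
  have KT: "X \<in> carrier T" if "X \<in> carrier ?K" for X
    using that T.double_centralizerD(1) by simp
  have prod: "finprod ?K B {..<k} \<in> carrier ?K" if "k \<le> n" for k
    using that B by (intro K.finprod_closed) auto
  have cols: "finprod ?K B {..<k} $$ (i, j) = \<zero>" if "k \<le> n" "j < k" "i < n" for i j k
    using that
  proof (induction k arbitrary: i j)
    case (Suc k)
    let ?p = "finprod ?K B {..<k}"
    have Bk: "B k \<in> carrier ?K" using B Suc.prems by simp
    have p: "?p \<in> carrier ?K" using Suc.prems by (intro prod) simp
    have "finprod ?K B {..<Suc k} = B k \<otimes>\<^bsub>?K\<^esub> ?p"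
      using Bk B Suc.prems by (simp add: lessThan_Suc)
    \<comment> \<open>Commutativity moves the new factor to the right, so that the zero columns of
      \<open>?p\<close> meet the rows of the triangular matrix \<open>B k\<close>.\<close>
    also have "\<dots> = ?p \<otimes>\<^bsub>?K\<^esub> B k" using K.m_comm[OF Bk p] .
    finally have eq: "finprod ?K B {..<Suc k} = ?p \<otimes>\<^bsub>T\<^esub> B k" by simp
    note b = carrier_T_D[OF KT[OF Bk]] and q = carrier_T_D[OF KT[OF p]]
    have "(\<Oplus>l\<in>{..<n}. ?p $$ (i, l) \<otimes> B k $$ (l, j)) = \<zero>"
    proof (rule add.finprod_one_eqI)
      fix l assume l: "l \<in> {..<n}"
      \<comment> \<open>Either column \<open>l\<close> of \<open>?p\<close> vanishes by induction,
        or the entry of \<open>B k\<close> lies below the diagonal, or it is the zero entry at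
        \<open>(k, k)\<close>. As \<open>j \<le> k\<close>, having \<open>l \<ge> k\<close> and
        \<open>l \<le> j\<close> forces \<open>l = j = k\<close>.\<close>
      consider "l < k" | "j < l" | "l = k" "j = k" using Suc.prems by linarith
      then show "?p $$ (i, l) \<otimes> B k $$ (l, j) = \<zero>"
      proof cases
        case 1
        then show ?thesis using Suc l b(2)[of l j] by simp
      next
        case 2
        then show ?thesis using Suc.prems l b(3)[of l j] q(2)[of i l] by simp
      next
        case 3
        then show ?thesis using Suc.prems l diag[of k] q(2)[of i l] by simp
      qed
    qed
    then show ?case unfolding eq using Suc.prems by (simp add: T_entry)
  qed simp
  show ?thesis
    by (rule T_eqI[OF KT[OF prod[OF order_refl]] T.zero_closed]) (simp add: cols T_entry)
qed

lemma diagonal_cring_double_centralizer: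
  assumes a: "a \<in> carrier T"
  shows "diagonal_cring (T\<lparr>carrier := double_centralizer T a\<rparr>) R n (\<lambda>i A. A $$ (i, i)) (scalar_mat R n)"
proof (intro diagonal_cring.intro diagonal_cring_axioms.intro)
  let ?K = "T\<lparr>carrier := double_centralizer T a\<rparr>"
  show "cring ?K" by (rule T.cring_double_centralizer[OF a])
  show "cring R" by (rule is_cring)
  show "(\<lambda>A. A $$ (i, i)) \<in> ring_hom ?K R" if "i < n" for i
    using diagonal_hom[OF that] T.double_centralizerD(1) by (auto simp: ring_hom_def)
  show "scalar_mat R n r \<in> carrier ?K" if "r \<in> carrier R" for r
    using that scalar_mat_closed scalar_mat_central by (auto simp: double_centralizer_def)
  show "scalar_mat R n r $$ (i, i) = r" if "i < n" for r i
    using that by (simp add: scalar_mat_def)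
  show "finprod ?K B {..<n} = \<zero>\<^bsub>?K\<^esub>"
    if "\<And>i. i < n \<Longrightarrow> B i \<in> carrier ?K" "\<And>i. i < n \<Longrightarrow> B i $$ (i, i) = \<zero>" for B
    using finprod_triangular_eq_zero[OF a, of B] that by simp
qed

text \<open>The commutative argument applies in the double centralizer of \<open>A\<close>, and an
  inverse found there is an inverse in \<open>T\<close>.\<close>

lemma T_Units_if_diagonal_Units:
  assumes A: "A \<in> carrier T" and u: "\<And>i. i < n \<Longrightarrow> A $$ (i, i) \<in> Units R"
  shows "A \<in> Units T"
proof -
  interpret K: diagonal_cring "T\<lparr>carrier := double_centralizer T A\<rparr>" R n "\<lambda>i A. A $$ (i, i)" "scalar_mat R n"
    by (rule diagonal_cring_double_centralizer[OF A])
  have "A \<in> Units (T\<lparr>carrier := double_centralizer T A\<rparr>)"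
    using T.double_centralizer_self[OF A] u by (intro K.Units_if_diagonal_Units) auto
  then show ?thesis by (auto simp: Units_def double_centralizer_def)
qed

lemma diagonal_minus:
  assumes "i < n" "A \<in> carrier T" "B \<in> carrier T"
  shows "(A \<ominus>\<^bsub>T\<^esub> B) $$ (i, i) = A $$ (i, i) \<ominus> B $$ (i, i)"
proof -
  interpret h: ring_hom_ring T R "\<lambda>A. A $$ (i, i)"
    using diagonal_hom[OF assms(1)] by unfold_locales
  show ?thesis using assms by (simp add: a_minus_def T_entry)
qed

text \<open>A unit \<open>U\<close> has units on its diagonal, hence so does \<open>1 - DU\<close>,
  and this suffices for invertibility.\<close>

lemma T_Delta_if_diagonal_Delta:
  assumes D: "D \<in> carrier T" and d: "\<And>i. i < n \<Longrightarrow> D $$ (i, i) \<in> Delta R"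
  shows "D \<in> Delta T"
proof -
  have "\<one>\<^bsub>T\<^esub> \<ominus>\<^bsub>T\<^esub> D \<otimes>\<^bsub>T\<^esub> U \<in> Units T" if U: "U \<in> Units T" for U
  proof (rule T_Units_if_diagonal_Units)
    have Uc: "U \<in> carrier T" using U by auto
    show "\<one>\<^bsub>T\<^esub> \<ominus>\<^bsub>T\<^esub> D \<otimes>\<^bsub>T\<^esub> U \<in> carrier T" using D Uc by simp
    fix i assume i: "i < n"
    have "(\<one>\<^bsub>T\<^esub> \<ominus>\<^bsub>T\<^esub> D \<otimes>\<^bsub>T\<^esub> U) $$ (i, i) = \<one> \<ominus> D $$ (i, i) \<otimes> U $$ (i, i)"
      using i D Uc ring_hom_mult[OF diagonal_hom[OF i] D Uc] by (simp add: diagonal_minus T_entry(3))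
    then show "(\<one>\<^bsub>T\<^esub> \<ominus>\<^bsub>T\<^esub> D \<otimes>\<^bsub>T\<^esub> U) $$ (i, i) \<in> Units R"
      using DeltaD[OF d[OF i] ring_hom_Units[OF diagonal_hom[OF i] U]] by simp
  qed
  then show ?thesis using D by (simp add: Delta_def)
qed

text \<open>The idempotent is built inside the double centralizer of \<open>A\<close>, so that it
  commutes with \<open>A\<close> and hence with the remainder.\<close>

lemma strongly_Delta_clean_triangular:
  assumes S: "strongly_Delta_clean R"
  shows "strongly_Delta_clean T"
  unfolding strongly_Delta_clean_def
proof
  fix A assume A: "A \<in> carrier T"
  have "\<exists>e d. e \<in> idempotents R \<and> d \<in> Delta R \<and> A $$ (i, i) = e \<oplus> d" if "i < n" for i
    using S carrier_T_D(2)[OF A that that] unfolding strongly_Delta_clean_def by blast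
  then obtain e d where e: "\<And>i. i < n \<Longrightarrow> e i \<in> idempotents R" and d: "\<And>i. i < n \<Longrightarrow> d i \<in> Delta R"
    and ed: "\<And>i. i < n \<Longrightarrow> A $$ (i, i) = e i \<oplus> d i"
    by metis
  let ?K = "T\<lparr>carrier := double_centralizer T A\<rparr>"
  interpret K: diagonal_cring ?K R n "\<lambda>i A. A $$ (i, i)" "scalar_mat R n"
    by (rule diagonal_cring_double_centralizer[OF A])
  obtain E where EK: "E \<in> idempotents ?K" and diag: "\<And>i. i < n \<Longrightarrow> E $$ (i, i) = e i"
    using K.lift_diagonal_idempotents[of A e d] T.double_centralizer_self[OF A] e d ed by auto
  have Edc: "E \<in> double_centralizer T A" and EE: "E \<otimes>\<^bsub>T\<^esub> E = E" using EK by (auto simp: idempotents_def)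
  have E: "E \<in> carrier T" and comm: "E \<otimes>\<^bsub>T\<^esub> A = A \<otimes>\<^bsub>T\<^esub> E"
    using T.double_centralizerD[OF Edc] A by auto
  \<comment> \<open>The diagonal of \<open>E\<close> consists of the \<open>e i\<close>, so that of
    the remainder consists of the \<open>d i\<close>.\<close>
  have "(A \<ominus>\<^bsub>T\<^esub> E) $$ (i, i) \<in> Delta R" if i: "i < n" for i
  proof -
    have c: "e i \<in> carrier R" "d i \<in> carrier R" using e[OF i] d[OF i] by (auto simp: idempotents_def)
    then have "e i \<oplus> d i \<ominus> e i = d i" by algebra
    then show ?thesis using i A E d[OF i] by (simp add: diagonal_minus ed diag)
  qed
  then have "A \<ominus>\<^bsub>T\<^esub> E \<in> Delta T" using A E by (intro T_Delta_if_diagonal_Delta) auto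
  moreover have "E \<in> idempotents T" using E EE by (simp add: idempotents_def)
  moreover have "A = E \<oplus>\<^bsub>T\<^esub> (A \<ominus>\<^bsub>T\<^esub> E)" using A E by algebra
  moreover have "E \<otimes>\<^bsub>T\<^esub> (A \<ominus>\<^bsub>T\<^esub> E) = (A \<ominus>\<^bsub>T\<^esub> E) \<otimes>\<^bsub>T\<^esub> E"
    using A E by (simp add: a_minus_def T.l_distr T.r_distr T.l_minus T.r_minus comm)
  ultimately show "\<exists>e\<in>idempotents T. \<exists>d\<in>Delta T. A = e \<oplus>\<^bsub>T\<^esub> d \<and> e \<otimes>\<^bsub>T\<^esub> d = d \<otimes>\<^bsub>T\<^esub> e"
    by blast
qed

text \<open>The corner entry \<open>(0, 0)\<close>, which exists because \<open>n \<ge> 1\<close>,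
  carries a decomposition of the scalar matrix of \<open>a\<close> back to one of
  \<open>a\<close>.\<close>

lemma strongly_Delta_clean_if_triangular:
  assumes n: "n \<ge> 1" and S: "strongly_Delta_clean T"
  shows "strongly_Delta_clean R"
  unfolding strongly_Delta_clean_def
proof
  fix a assume a: "a \<in> carrier R"
  have n0: "0 < n" using n by simp
  note hom = diagonal_hom[OF n0]
  obtain E D where E: "E \<in> idempotents T" and D: "D \<in> Delta T" and eq: "scalar_mat R n a = E \<oplus>\<^bsub>T\<^esub> D"
    using S scalar_mat_closed[OF a] unfolding strongly_Delta_clean_def by blast
  have c: "E \<in> carrier T" "D \<in> carrier T" using E D by (auto simp: idempotents_def Delta_def)
  have ent: "E $$ (0, 0) \<in> carrier R" "D $$ (0, 0) \<in> carrier R"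
    using carrier_T_D(2)[OF c(1) n0 n0] carrier_T_D(2)[OF c(2) n0 n0] .
  have "a = scalar_mat R n a $$ (0, 0)" using n0 by (simp add: scalar_mat_def)
  then have sum: "a = E $$ (0, 0) \<oplus> D $$ (0, 0)" by (simp add: eq T_entry n0)
  have "E $$ (0, 0) \<in> idempotents R"
    using ring_hom_mult[OF hom c(1) c(1)] E ent by (simp add: idempotents_def)
  \<comment> \<open>Every unit \<open>u\<close> is the corner of an invertible scalar matrix, so
    testing \<open>D\<close> against scalar matrices yields the condition for its corner.\<close>
  moreover have "D $$ (0, 0) \<in> Delta R"
  proof (rule DeltaI[OF ent(2)])
    fix u assume u: "u \<in> Units R"
    have sc: "scalar_mat R n u \<in> carrier T" using scalar_mat_Units[OF u] by auto
    have "\<one>\<^bsub>T\<^esub> \<ominus>\<^bsub>T\<^esub> D \<otimes>\<^bsub>T\<^esub> scalar_mat R n u \<in> Units T"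
      using D scalar_mat_Units[OF u] by (simp add: Delta_def)
    from ring_hom_Units[OF hom this] show "\<one> \<ominus> D $$ (0, 0) \<otimes> u \<in> Units R"
      using n0 c sc u ent by (simp add: diagonal_minus scalar_mat_mult T_entry(3) Units_closed m_comm)
  qed
  ultimately show "\<exists>e\<in>idempotents R. \<exists>d\<in>Delta R. a = e \<oplus> d \<and> e \<otimes> d = d \<otimes> e"
    using sum ent m_comm by blast
qed

end

theorem corollary4p3:
  fixes R :: "('a, 'm) ring_scheme"
  assumes "cring R"
  shows "(strongly_Delta_clean R \<longleftrightarrow> uniquely_clean R)
    \<and> (uniquely_clean R \<longleftrightarrow> (\<exists>n\<ge>1. strongly_Delta_clean (upper_triangular_ring R n)))
    \<and> ((\<exists>n\<ge>1. strongly_Delta_clean (upper_triangular_ring R n))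
        \<longleftrightarrow> (\<forall>n\<ge>1. strongly_Delta_clean (upper_triangular_ring R n)))"
proof -
  have 12: "strongly_Delta_clean R \<longleftrightarrow> uniquely_clean R"
    using cring.uniquely_clean_if_strongly_Delta_clean[OF assms]
      cring.strongly_Delta_clean_if_uniquely_clean[OF assms] by blast
  have triangular: "cring_triangular R" using assms by (simp add: cring_triangular_def)
  have 14: "strongly_Delta_clean (upper_triangular_ring R n)" if "strongly_Delta_clean R" for n
    by (rule cring_triangular.strongly_Delta_clean_triangular[OF triangular that])
  have 31: "strongly_Delta_clean R"
    if "n \<ge> 1" "strongly_Delta_clean (upper_triangular_ring R n)" for n
    by (rule cring_triangular.strongly_Delta_clean_if_triangular[OF triangular that])
  \<comment> \<open>Passing from all \<open>n \<ge> 1\<close> to some such \<open>n\<close> requires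
    that an admissible size exists.\<close>
  have "\<exists>n. 1 \<le> (n::nat)" by blast
  then show ?thesis using 12 14 31 by blast
qed

end
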